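(* Let $n$ be a positive integer. In the order ideal game $\mathcal{G}(\mathrm{ASM}_n,\mathcal{OI})$, the Grundy value of $(x,y,z)\in\mathrm{ASM}_n$ is $g(x,y,z)=1$ if $\pi(x,y,z)=(0,0)$ or $\pi(x,y,z)\in\{(2k+1,k),(2k+1,k+1)\}$ for some $k\in\mathbb{Z}_{\ge0}$, and $g(x,y,z)=0$ otherwise, where $\pi(x,y,z)=(n-2-(x+y),\,z)$.
   Context: $\mathrm{ASM}_n=\{(x,y,z)\in\mathbb{Z}_{\ge0}^3 : x+y+z\le n-2\}$, partially ordered by $(x,y,z)\le(x_0,y_0,z_0)$ iff $x\ge x_0$, $y\ge y_0$, $z\le z_0$ and $x+y+z\ge x_0+y_0+z_0$. For $\mathbf{x}\in\mathrm{ASM}_n$, $\Lambda_{\mathbf{x}}=\{\mathbf{y}\in\mathrm{ASM}_n:\mathbf{y}\le\mathbf{x}\}$ is the principal order ideal, and $\mathcal{OI}=\{\Lambda_{\mathbf{x}}:\mathbf{x}\in\mathrm{ASM}_n\}$. Coin-turning game $\mathcal{G}(X,\mathcal{T})$ (for a finite poset $X$ and a family $\mathcal{T}$ of nonempty subsets each with a maximum): a position is $H\subseteq X$; a move chooses $T\in\mathcal{T}$ with $\max T\in H$ and replaces $H$ by $H\triangle T$; a player unable to move loses. The Grundy value $g(\mathbf{x})$ is the Sprague–Grundy value of the position $\{\mathbf{x}\}$; equivalently $g(\mathbf{x})=\operatorname{mex}\{\bigoplus_{t\in T\setminus\{\mathbf{x}\}}g(t):T\in\mathcal{T},\max T=\mathbf{x}\}$,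 with $\oplus$ the nim-sum (bitwise XOR) and $\operatorname{mex}$ the least nonnegative integer not in the set. *)

theory Defs
  imports Main
begin

definition mex :: "nat set \<Rightarrow> nat" where
  "mex A = (LEAST k. k \<notin> A)"

text \<open>
  An impartial game under normal play is given by its set \<open>M\<close> of moves, where \<open>(p, q) \<in> M\<close> means
  that \<open>q\<close> is an option of \<open>p\<close>. If \<open>M\<close> is terminating, then \<open>sg_value M\<close> is the unique function
  with \<open>sg_value M p = mex (sg_value M ` (M `` {p}))\<close>; see lemma \<open>sg_value_eq\<close> below.
\<close>

definition sg_value :: "('p \<times> 'p) set \<Rightarrow> 'p \<Rightarrow> nat" where
  "sg_value M = wfrec (M\<inverse>) (\<lambda>f p. mex (f ` (M `` {p})))"

lemma sg_value_eq:
  assumes "wf (M\<inverse>)"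
  shows "sg_value M p = mex (sg_value M ` (M `` {p}))"
proof -
  have "sg_value M p = mex (cut (sg_value M) (M\<inverse>) p ` (M `` {p}))"
    unfolding sg_value_def by (subst wfrec[OF assms]) simp
  also have "cut (sg_value M) (M\<inverse>) p ` (M `` {p}) = sg_value M ` (M `` {p})"
    by (rule image_cong) (auto simp: cut_apply)
  finally show ?thesis .
qed

text \<open>Partial orders are relations \<open>r\<close>, where \<open>(a, b) \<in> r\<close> means \<open>a \<le> b\<close>.\<close>

definition is_maximum :: "('a \<times> 'a) set \<Rightarrow> 'a set \<Rightarrow> 'a \<Rightarrow> bool" where
  "is_maximum r T m \<longleftrightarrow> m \<in> T \<and> (\<forall>t\<in>T. (t, m) \<in> r)"

definition ct_moves :: "'a set \<Rightarrow> ('a \<times> 'a) set \<Rightarrow> 'a set set \<Rightarrow> ('a set \<times> 'a set) set" where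
  "ct_moves X r \<T> =
    {(H, H'). H \<subseteq> X \<and> (\<exists>T\<in>\<T>. \<exists>m\<in>H. is_maximum r T m \<and> H' = sym_diff H T)}"

definition grundy_value :: "'a set \<Rightarrow> ('a \<times> 'a) set \<Rightarrow> 'a set set \<Rightarrow> 'a \<Rightarrow> nat" where
  "grundy_value X r \<T> x = sg_value (ct_moves X r \<T>) {x}"

locale coin_turning_game =
  fixes X :: "'a set" and r :: "('a \<times> 'a) set" and \<T> :: "'a set set"
  assumes finite_X: "finite X"
    and partial_order: "partial_order_on X r"
    and turning_sets: "\<And>T. T \<in> \<T> \<Longrightarrow> T \<subseteq> X \<and> T \<noteq> {} \<and> (\<exists>m. is_maximum r T m)"
begin

lemma wf_ct_moves: "wf ((ct_moves X r \<T>)\<inverse>)"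
proof -
  define below where "below x = {y \<in> X. (y, x) \<in> r \<and> y \<noteq> x}" for x
  define w where "w x = Suc (card X) ^ card (below x)" for x
  have tr: "trans r" and an: "antisym r"
    using partial_order by (auto simp: partial_order_on_def preorder_on_def)
  have fin_below: "finite (below x)" for x
    using finite_X by (simp add: below_def)
  have "(ct_moves X r \<T>)\<inverse> \<subseteq> measure (\<lambda>H. sum w H)"
  proof (rule subsetI, clarify)
    fix H' H assume "(H, H') \<in> ct_moves X r \<T>"
    then obtain T m where H: "H \<subseteq> X" and T: "T \<in> \<T>" and m: "m \<in> H" "is_maximum r T m"
      and H': "H' = sym_diff H T"
      by (auto simp: ct_moves_def)
    have TX: "T \<subseteq> X" and mT: "m \<in> T" using turning_sets[OF T] m(2) by (auto simp: is_maximum_def)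
    have fin: "finite H" "finite T" using H TX finite_X finite_subset by auto
    have small: "Suc (card X) * w t \<le> w m" if t: "t \<in> T - {m}" for t
    proof -
      have tm: "(t, m) \<in> r" "t \<noteq> m" "t \<in> X" using t m(2) TX by (auto simp: is_maximum_def)
      have "below t \<subset> below m"
      proof (rule psubsetI)
        show "below t \<subseteq> below m"
          using tm tr an by (auto simp: below_def dest: transD antisymD)
        show "below t \<noteq> below m" using tm by (auto simp: below_def)
      qed
      hence "card (below t) < card (below m)" by (simp add: fin_below psubset_card_mono)
      hence "Suc (card X) ^ Suc (card (below t)) \<le> Suc (card X) ^ card (below m)"
        by (intro power_increasing) auto
      thus ?thesis by (simp add: w_def)
    qed
    have "Suc (card X) * sum w (T - {m}) \<le> card (T - {m}) * w m"
      using sum_mono[of "T - {m}" "\<lambda>t. Suc (card X) * w t" "\<lambda>_. w m"] small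
      by (simp add: sum_distrib_left)
    also have "\<dots> \<le> card X * w m"
      using TX finite_X by (intro mult_right_mono card_mono) auto
    also have "\<dots> < Suc (card X) * w m" by (simp add: w_def)
    finally have lt: "sum w (T - {m}) < w m" using mult_less_cancel1 by blast
    have "sum w H' \<le> sum w ((H - {m}) \<union> (T - {m}))"
      using fin m(1) mT by (intro sum_mono2) (auto simp: H')
    also have "\<dots> \<le> sum w (H - {m}) + sum w (T - {m})"
      using sum.union_inter[of "H - {m}" "T - {m}" w] fin by simp
    also have "\<dots> < sum w (H - {m}) + w m" using lt by simp
    also have "\<dots> = sum w H" using fin m(1) by (simp add: sum.remove)
    finally show "(H', H) \<in> measure (\<lambda>H. sum w H)" by simp
  qed
  thus ?thesis using wf_subset wf_measure by blast
qed

end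

definition ASM :: "nat \<Rightarrow> (nat \<times> nat \<times> nat) set" where
  "ASM n = {(x, y, z). int x + int y + int z \<le> int n - 2}"

definition asm_order :: "nat \<Rightarrow> ((nat \<times> nat \<times> nat) \<times> (nat \<times> nat \<times> nat)) set" where
  "asm_order n = {((x, y, z), (x\<^sub>0, y\<^sub>0, z\<^sub>0)). (x, y, z) \<in> ASM n \<and> (x\<^sub>0, y\<^sub>0, z\<^sub>0) \<in> ASM n \<and>
     x \<ge> x\<^sub>0 \<and> y \<ge> y\<^sub>0 \<and> z \<le> z\<^sub>0 \<and> x + y + z \<ge> x\<^sub>0 + y\<^sub>0 + z\<^sub>0}"

definition principal_ideal :: "nat \<Rightarrow> nat \<times> nat \<times> nat \<Rightarrow> (nat \<times> nat \<times> nat) set" where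
  "principal_ideal n p = {q \<in> ASM n. (q, p) \<in> asm_order n}"

definition order_ideals :: "nat \<Rightarrow> (nat \<times> nat \<times> nat) set set" where
  "order_ideals n = principal_ideal n ` ASM n"

definition asm_proj :: "nat \<Rightarrow> nat \<times> nat \<times> nat \<Rightarrow> int \<times> int" where
  "asm_proj n = (\<lambda>(x, y, z). (int n - 2 - (int x + int y), int z))"

lemma finite_ASM: "finite (ASM n)"
proof (rule finite_subset)
  show "ASM n \<subseteq> {..n} \<times> {..n} \<times> {..n}" by (auto simp: ASM_def)
qed simp

lemma partial_order_asm: "partial_order_on (ASM n) (asm_order n)"
  unfolding partial_order_on_def preorder_on_def
  by (auto simp: refl_on_def asm_order_def intro!: transI antisymI)

interpretation order_ideal_game: coin_turning_game "ASM n" "asm_order n" "order_ideals n" for n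
proof
  show "finite (ASM n)" by (rule finite_ASM)
  show "partial_order_on (ASM n) (asm_order n)" by (rule partial_order_asm)
next
  fix T assume "T \<in> order_ideals n"
  then obtain p where p: "p \<in> ASM n" "T = principal_ideal n p" by (auto simp: order_ideals_def)
  have max: "is_maximum (asm_order n) T p"
    using p by (auto simp: is_maximum_def principal_ideal_def asm_order_def)
  moreover have "T \<subseteq> ASM n" using p by (auto simp: principal_ideal_def)
  moreover have "p \<in> T" using max by (simp add: is_maximum_def)
  ultimately show "T \<subseteq> ASM n \<and> T \<noteq> {} \<and> (\<exists>m. is_maximum (asm_order n) T m)"
    by blast
qed

end

theory Submission
  imports Defs
begin

text \<open>
  Suppose a set \<open>A\<close> meets every turning set in an odd number of points. Then each move
  changes the parity of \<open>card (H \<inter> A)\<close>, so this parity is the Sprague--Grundy value of \<open>H\<close>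
  as soon as every nonempty position has a move.

  For the order ideal game, \<open>A\<close> is the set of claimed points of value 1. Swapping the offsets
  \<open>x - x\<^sub>0\<close> and \<open>y - y\<^sub>0\<close> is an involution of the ideal of \<open>(x\<^sub>0, y\<^sub>0, z\<^sub>0)\<close> preserving \<open>A\<close>, so only
  its fixed points matter. With \<open>(a, b) = \<pi>(x, y, z)\<close> and \<open>(a\<^sub>0, b\<^sub>0) = \<pi>(x\<^sub>0, y\<^sub>0, z\<^sub>0)\<close>,
  they satisfy \<open>a \<equiv> a\<^sub>0\<close> modulo 2.
  If \<open>a\<^sub>0\<close> is even, the only one in \<open>A\<close> lies over \<open>(0, 0)\<close>; if \<open>a\<^sub>0\<close> is odd, then with
  \<open>c\<^sub>0 = a\<^sub>0 - b\<^sub>0 \<noteq> b\<^sub>0\<close> their number is \<open>min (b\<^sub>0 + 1) c\<^sub>0 + min b\<^sub>0 (c\<^sub>0 + 1) = 2 * min b\<^sub>0 c\<^sub>0 + 1\<close>.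
\<close>

lemma mex_empty: "mex {} = 0"
  by (simp add: mex_def)

lemma mex_singleton: "mex {v} = (if v = 0 then 1 else 0)"
  unfolding mex_def by (auto intro!: Least_equality)

lemma odd_card_sym_diff_Int:
  assumes "finite H" "finite T" "odd (card (T \<inter> A))"
  shows "odd (card (sym_diff H T \<inter> A)) \<longleftrightarrow> even (card (H \<inter> A))"
proof -
  let ?I = "H \<inter> T \<inter> A"
  have "card (H \<inter> A) = card ((H - T) \<inter> A) + card ?I"
    using assms by (subst card_Un_disjoint[symmetric]) (auto intro: arg_cong[where f = card])
  moreover have "card (T \<inter> A) = card ((T - H) \<inter> A) + card ?I"
    using assms by (subst card_Un_disjoint[symmetric]) (auto intro: arg_cong[where f = card])
  moreover have "card (sym_diff H T \<inter> A) = card ((H - T) \<inter> A) + card ((T - H) \<inter> A)"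
    using assms by (subst card_Un_disjoint[symmetric]) (auto intro: arg_cong[where f = card])
  ultimately show ?thesis using assms(3) by auto
qed

lemma (in coin_turning_game) sg_value_eq_parity:
  assumes odd_A: "\<And>T. T \<in> \<T> \<Longrightarrow> odd (card (T \<inter> A))"
    and movable: "\<And>x. x \<in> X \<Longrightarrow> \<exists>T\<in>\<T>. is_maximum r T x"
    and "H \<subseteq> X"
  shows "sg_value (ct_moves X r \<T>) H = card (H \<inter> A) mod 2"
  using \<open>H \<subseteq> X\<close>
proof (induction H rule: wf_induct_rule[OF wf_ct_moves])
  case (1 H)
  let ?M = "ct_moves X r \<T>"
  have eq: "sg_value ?M H = mex (sg_value ?M ` (?M `` {H}))"
    by (rule sg_value_eq[OF wf_ct_moves])
  show ?case
  proof (cases "H = {}")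
    case True
    then have "?M `` {H} = {}" by (auto simp: ct_moves_def)
    with eq True show ?thesis by (simp add: mex_empty)
  next
    case False
    \<comment> \<open>All options share the parity opposite to that of \<open>H\<close>. Once some
      option exists, the option values form a singleton of 0 or 1, and its \<open>mex\<close> is the
      other bit.\<close>
    have "sg_value ?M H' = 1 - card (H \<inter> A) mod 2" if "(H, H') \<in> ?M" for H'
    proof -
      from that obtain T where T: "T \<in> \<T>" and H': "H' = sym_diff H T"
        by (auto simp: ct_moves_def)
      have TX: "T \<subseteq> X" using turning_sets[OF T] by simp
      have "odd (card (H' \<inter> A)) \<longleftrightarrow> even (card (H \<inter> A))"
        unfolding H' using TX "1.prems" finite_X odd_A[OF T]
        by (intro odd_card_sym_diff_Int) (auto intro: finite_subset)
      moreover have "sg_value ?M H' = card (H' \<inter> A) mod 2"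
        using that TX "1.prems" by (intro "1.IH") (auto simp: H')
      ultimately show ?thesis by (cases "even (card (H \<inter> A))") (auto simp: odd_iff_mod_2_eq_one)
    qed
    moreover have "?M `` {H} \<noteq> {}"
    proof -
      from False obtain m where m: "m \<in> H" by auto
      with "1.prems" movable obtain T where "T \<in> \<T>" "is_maximum r T m" by blast
      with m "1.prems" have "(H, sym_diff H T) \<in> ?M" unfolding ct_moves_def by blast
      then show ?thesis by blast
    qed
    ultimately have "sg_value ?M ` (?M `` {H}) = {1 - card (H \<inter> A) mod 2}"
      by auto
    with eq show ?thesis by (simp add: mex_singleton) presburger
  qed
qed

text \<open>Orbits \<open>{s, f s}\<close> have exactly two points; removing one leaves a smaller
  set that is still closed under \<open>f\<close>.\<close>

lemma even_card_fixed_point_free_involution: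
  assumes "finite S" "\<And>s. s \<in> S \<Longrightarrow> f s \<in> S \<and> f (f s) = s \<and> f s \<noteq> s"
  shows "even (card S)"
  using assms
proof (induction S rule: finite_psubset_induct)
  case (psubset S)
  show ?case
  proof (cases "S = {}")
    case False
    then obtain s where s: "s \<in> S" by auto
    have "even (card (S - {s, f s}))"
    proof (rule psubset.IH)
      show "S - {s, f s} \<subset> S" using s by auto
      fix t assume t: "t \<in> S - {s, f s}"
      then have "f t \<noteq> s" "f t \<noteq> f s" using psubset.prems[of t] psubset.prems[OF s] by auto
      with t show "f t \<in> S - {s, f s} \<and> f (f t) = t \<and> f t \<noteq> t"
        using psubset.prems[of t] by auto
    qed
    moreover have "card S = card (S - {s, f s}) + card {s, f s}"
      using s psubset.prems[OF s] psubset.hyps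
      by (metis Diff_partition card_Diff_subset card_mono empty_subsetI finite.emptyI
          finite_insert insert_subset le_add_diff_inverse2)
    moreover have "card {s, f s} = 2" using psubset.prems[OF s] by auto
    ultimately show ?thesis by simp
  qed simp
qed

lemma even_card_involution_iff:
  assumes "finite S" "\<And>s. s \<in> S \<Longrightarrow> f s \<in> S \<and> f (f s) = s"
  shows "even (card S) \<longleftrightarrow> even (card {s \<in> S. f s = s})"
proof -
  have "even (card {s \<in> S. f s \<noteq> s})"
    by (rule even_card_fixed_point_free_involution[where f = f]) (use assms in auto)
  moreover have "card S = card {s \<in> S. f s = s} + card {s \<in> S. f s \<noteq> s}"
    using assms(1) by (subst card_Un_disjoint[symmetric]) (auto intro: arg_cong[where f = card])
  ultimately show ?thesis by simp
qed

definition grundy_one :: "nat \<Rightarrow> (nat \<times> nat \<times> nat) set" where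
  "grundy_one n = {p. asm_proj n p = (0, 0) \<or>
     (\<exists>k::nat. asm_proj n p \<in> {(2 * int k + 1, int k), (2 * int k + 1, int k + 1)})}"

lemma odd_card_ideal_Int_grundy_one:
  assumes "p \<in> ASM n"
  shows "odd (card (principal_ideal n p \<inter> grundy_one n))"
proof -
  obtain x\<^sub>0 y\<^sub>0 b where p: "p = (x\<^sub>0, y\<^sub>0, b)" by (cases p)
  \<comment> \<open>This subtraction is exact because \<open>p\<close> lies in \<open>ASM n\<close>.
    In the notation above, \<open>b\<close> and \<open>c\<close> are \<open>b\<^sub>0\<close> and
    \<open>c\<^sub>0\<close>, and \<open>a\<^sub>0 = b + c\<close>.\<close>
  define c where "c = n - 2 - x\<^sub>0 - y\<^sub>0 - b"
  have n: "n = x\<^sub>0 + y\<^sub>0 + b + c + 2" using assms by (auto simp: p ASM_def c_def)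
  let ?S = "principal_ideal n p \<inter> grundy_one n"
  \<comment> \<open>In terms of the offsets \<open>i\<close> and \<open>j\<close>, the first
    projected coordinate is \<open>b + c - (i + j)\<close>; the equations state without subtraction
    that it is 0 or \<open>2 * k + 1\<close>.\<close>
  have S_iff: "(x, y, z) \<in> ?S \<longleftrightarrow>
      (\<exists>i j. x = x\<^sub>0 + i \<and> y = y\<^sub>0 + j \<and> z \<le> b \<and> b \<le> i + j + z \<and> i + j + z \<le> b + c \<and>
        (i + j = b + c \<and> z = 0 \<or>
         (\<exists>k. i + j + 2 * k + 1 = b + c \<and> (z = k \<or> z = k + 1))))" for x y z
  proof (cases "x\<^sub>0 \<le> x \<and> y\<^sub>0 \<le> y")
    case True
    then obtain i j where ij: "x = x\<^sub>0 + i" "y = y\<^sub>0 + j" by (auto simp: le_iff_add)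
    have "(x, y, z) \<in> principal_ideal n p \<longleftrightarrow> z \<le> b \<and> b \<le> i + j + z \<and> i + j + z \<le> b + c"
      by (auto simp: principal_ideal_def asm_order_def ASM_def p n ij)
    moreover have "(x, y, z) \<in> grundy_one n \<longleftrightarrow> i + j = b + c \<and> z = 0 \<or>
         (\<exists>k. i + j + 2 * k + 1 = b + c \<and> (z = k \<or> z = k + 1))"
    proof -
      have "int n - 2 - (int x + int y) = int (b + c) - int (i + j)" by (simp add: n ij)
      moreover have "int (b + c) - int (i + j) = 2 * int k + 1 \<longleftrightarrow> i + j + 2 * k + 1 = b + c" for k
        by linarith
      moreover have "int z = int k + 1 \<longleftrightarrow> z = k + 1" for k by linarith
      moreover have "int (b + c) - int (i + j) = 0 \<longleftrightarrow> i + j = b + c" by linarith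
      ultimately show ?thesis
        by (simp only: grundy_one_def asm_proj_def mem_Collect_eq prod.case prod.inject insert_iff
            empty_iff simp_thms of_nat_eq_iff of_nat_eq_0_iff) blast
    qed
    ultimately show ?thesis by (simp add: ij)
  qed (auto simp: principal_ideal_def asm_order_def p)
  \<comment> \<open>Subtraction truncates, so \<open>f\<close> is an involution only where
    \<open>x\<^sub>0 \<le> x\<close> and \<open>y\<^sub>0 \<le> y\<close>, which holds on
    \<open>?S\<close>.\<close>
  define f where "f = (\<lambda>(x, y, z::nat). (x\<^sub>0 + (y - y\<^sub>0), y\<^sub>0 + (x - x\<^sub>0), z))"
  let ?F = "{s \<in> ?S. f s = s}"
  have F_iff: "(x, y, z) \<in> ?F \<longleftrightarrow>
      (\<exists>i. x = x\<^sub>0 + i \<and> y = y\<^sub>0 + i \<and> z \<le> b \<and> b \<le> 2 * i + z \<and> 2 * i + z \<le> b + c \<and>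
        (2 * i = b + c \<and> z = 0 \<or>
         (\<exists>k. 2 * i + 2 * k + 1 = b + c \<and> (z = k \<or> z = k + 1))))" for x y z
    unfolding mem_Collect_eq S_iff by (auto simp: f_def)
  have "finite ?S"
    by (rule finite_subset[OF _ finite_ASM[of n]]) (auto simp: principal_ideal_def)
  moreover have "f s \<in> ?S \<and> f (f s) = s" if sS: "s \<in> ?S" for s
  proof -
    obtain x y z where s: "s = (x, y, z)" by (cases s)
    obtain i j where ij: "x = x\<^sub>0 + i" "y = y\<^sub>0 + j"
      using sS unfolding s S_iff by blast
    have "f s = (x\<^sub>0 + j, y\<^sub>0 + i, z)" by (simp add: f_def s ij)
    moreover have "(x\<^sub>0 + j, y\<^sub>0 + i, z) \<in> ?S"
      using sS unfolding s S_iff ij by (auto simp: add.commute[of i j])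
    ultimately show ?thesis by (simp add: f_def s ij)
  qed
  ultimately have parity: "even (card ?S) \<longleftrightarrow> even (card ?F)"
    by (rule even_card_involution_iff)
  have "odd (card ?F)"
  proof (cases "even (b + c)")
    case True
    then obtain d where d: "b + c = 2 * d" by (elim evenE)
    have "s \<in> ?F \<longleftrightarrow> s = (x\<^sub>0 + d, y\<^sub>0 + d, 0)" for s
    proof -
      obtain x y z where s: "s = (x, y, z)" by (cases s)
      have "2 * i + 2 * k + 1 \<noteq> b + c" for i k using d by presburger
      then show ?thesis unfolding s F_iff using d by auto
    qed
    then have "?F = {(x\<^sub>0 + d, y\<^sub>0 + d, 0)}" by blast
    then show ?thesis by simp
  next
    case False
    then obtain d where d: "b + c = 2 * d + 1" by (elim oddE)
    \<comment> \<open>The fixed point with \<open>a = 2 * k + 1\<close> and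
      \<open>z = k + t\<close>: its common offset solves
      \<open>2 * i + 2 * k + 1 = 2 * d + 1\<close>.\<close>
    define e where "e = (\<lambda>t k. (x\<^sub>0 + (d - k), y\<^sub>0 + (d - k), k + t :: nat))"
    \<comment> \<open>For \<open>z = k + t\<close>, the condition \<open>z \<le> b\<close> becomes
      \<open>k + t \<le> b\<close>, and \<open>b \<le> 2 * i + z\<close> becomes
      \<open>k < c + t\<close>; the remaining bound follows from \<open>t \<le> 1\<close>.\<close>
    have F_eq: "?F = e 0 ` {..<min (b + 1) c} \<union> e 1 ` {..<min b (c + 1)}"
    proof (rule set_eqI)
      fix s :: "nat \<times> nat \<times> nat"
      obtain x y z where s: "s = (x, y, z)" by (cases s)
      show "s \<in> ?F \<longleftrightarrow> s \<in> e 0 ` {..<min (b + 1) c} \<union> e 1 ` {..<min b (c + 1)}"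
      proof
        assume "s \<in> ?F"
        then obtain i k where ik: "x = x\<^sub>0 + i" "y = y\<^sub>0 + i" "z \<le> b" "b \<le> 2 * i + z"
            "2 * i + 2 * k + 1 = b + c" "z = k \<or> z = k + 1"
          unfolding s F_iff using \<open>odd (b + c)\<close> by (metis dvd_triv_left)
        have "i = d - k" using ik(5) d by simp
        then have "s = e (z - k) k" using ik by (auto simp: s e_def)
        moreover have "z = k \<Longrightarrow> k < min (b + 1) c" "z = k + 1 \<Longrightarrow> k < min b (c + 1)"
          using ik by auto
        ultimately show "s \<in> e 0 ` {..<min (b + 1) c} \<union> e 1 ` {..<min b (c + 1)}"
          using ik(6) by auto
      next
        assume "s \<in> e 0 ` {..<min (b + 1) c} \<union> e 1 ` {..<min b (c + 1)}"
        then obtain k where k: "k < min (b + 1) c \<and> s = e 0 k \<or> k < min b (c + 1) \<and> s = e 1 k"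
          by blast
        then have xyz: "x = x\<^sub>0 + (d - k)" "y = y\<^sub>0 + (d - k)"
            "k < min (b + 1) c \<and> z = k \<or> k < min b (c + 1) \<and> z = k + 1"
          by (auto simp: s e_def)
        then have "2 * (d - k) + 2 * k + 1 = b + c" "z = k \<or> z = k + 1" "z \<le> b"
            "b \<le> 2 * (d - k) + z" "2 * (d - k) + z \<le> b + c"
          using d by auto
        then show "s \<in> ?F" unfolding s F_iff using xyz by blast
      qed
    qed
    have inj: "inj_on (e t) K" for t K by (auto simp: e_def inj_on_def)
    \<comment> \<open>On both ranges \<open>k \<le> d\<close>, so the first coordinate determines
      \<open>k\<close>, and then the third one determines \<open>t\<close>.\<close>
    have disj: "e 0 ` {..<min (b + 1) c} \<inter> e 1 ` {..<min b (c + 1)} = {}"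
      using d by (auto simp: e_def)
    have "card ?F = min (b + 1) c + min b (c + 1)"
      unfolding F_eq using card_Un_disjoint[OF _ _ disj] by (simp add: card_image[OF inj])
    also have "\<dots> = 2 * min b c + 1" using d by (auto simp: min_def) presburger+
    finally show ?thesis by simp
  qed
  with parity show ?thesis by simp
qed

theorem mainTheorem7:
  fixes n x y z :: nat
  assumes "n > 0"
    and "(x, y, z) \<in> ASM n"
  shows "grundy_value (ASM n) (asm_order n) (order_ideals n) (x, y, z) =
    (if asm_proj n (x, y, z) = (0, 0) \<or>
        (\<exists>k::nat. asm_proj n (x, y, z) \<in> {(2 * int k + 1, int k), (2 * int k + 1, int k + 1)})
     then 1 else 0)"
proof -
  have "grundy_value (ASM n) (asm_order n) (order_ideals n) (x, y, z)
      = card ({(x, y, z)} \<inter> grundy_one n) mod 2"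
    unfolding grundy_value_def
  proof (rule order_ideal_game.sg_value_eq_parity)
    show "odd (card (T \<inter> grundy_one n))" if "T \<in> order_ideals n" for T
      using that by (auto simp: order_ideals_def odd_card_ideal_Int_grundy_one)
    show "\<exists>T\<in>order_ideals n. is_maximum (asm_order n) T q" if "q \<in> ASM n" for q
      using that unfolding order_ideals_def
      by (intro bexI[of _ "principal_ideal n q"])
        (auto simp: is_maximum_def principal_ideal_def asm_order_def)
  qed (use assms in simp)
  also have "\<dots> = (if (x, y, z) \<in> grundy_one n then 1 else 0)" by simp
  finally show ?thesis by (simp only: grundy_one_def mem_Collect_eq)
qed

end
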